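(* Let $T\subset\mathbb{R}$ be compact, $D\subset\mathbb{R}^2$, let $s_1,\ldots,s_n\in D$ be $n$ different locations and $s_0\in D$ a new location. Suppose that: (1) The random functions $\chi_{s_i}$ can be represented as $\chi_{s_i}(t)=\mathbf{a}_i^{\intercal}\mathbf{B}(t)$, $t\in T$, where $\mathbf{B}(t)=(B_1(t),\ldots,B_p(t))^{\intercal}$ are known basis functions. (2) $\mathbf{a}_i=\mathbf{a}(s_i)$ follows a linear model of coregionalization with $q$ independent second-order (isotropically) stationary latent univariate spatial random fields with common variogram; that is, $\mathbf{a}(s)=\mathbf{P}\,\mathbf{r}(s)$, where $\mathbf{P}\in\mathbb{R}^{p\times q}$ is a constant matrix and $\mathbf{r}(s)=(r_1(s),\ldots,r_q(s))^{\intercal}$ consists of $q$ independent, second-order isotropically stationary, real-valued random fields on $D$ which all have the same variogram. (3) The known basis functions $\mathbf{B}_\lambda(t)=(B_{\lambda 1}(t),\ldots,B_{\lambda K}(t))^{\intercal}$ satisfy $\mathbf{c}^{\intercal}\mathbf{B}_\lambda(t)=1$ for all $t\in T$, for some constant vector $\mathbf{c}\in\mathbb{R}^K$. (4) The inverse of the $K\times K$ matrix $$\mathbf{G}=\int_T \mathbf{B}^{\intercal}(t)\,\mathbf{P}\mathbf{P}^{\intercal}\,\mathbf{B}(t)\;\mathbf{B}_\lambda(t)\mathbf{B}_\lambda^{\intercal}(t)\,dt$$ exists. Then the optimal PWFK kriging weights $\lambda_i(t)=\mathbf{b}_i^{\intercal}\mathbf{B}_\lambda(t)$ that minimize $\mathrm{MISE}(s_0)$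 (subject to the unbiasedness constraint) are constant in $t$: they satisfy $\lambda_i(t)=\lambda_i$ for all $t\in T$, with $\mathbf{b}_i=\lambda_i\mathbf{c}$, for all $i=1,\ldots,n$, and thus they coincide with the optimal kriging weights of OKFD.
   Context: Second-order isotropic stationarity: a real-valued random field $\{r(s):s\in D\}$ is second-order isotropically stationary if $E[r(s)]$ and $V[r(s)]$ (finite) do not depend on $s$, and $\mathrm{Cov}[r(s),r(v)]$ depends only on the Euclidean distance $\|s-v\|$. Its variogram is $2\gamma(h)=V[r(s)-r(v)]$ with $h=\|s-v\|$. For a predictor $\hat\chi_{s_0}(t)$, $t\in T$, of $\chi_{s_0}$ based on $\chi_{s_1},\ldots,\chi_{s_n}$, the mean integrated squared error is $$\mathrm{MISE}(s_0)=E\Big[\int_T\big(\hat\chi_{s_0}(t)-\chi_{s_0}(t)\big)^2\,dt\Big].$$ Pointwise functional kriging (PWFK): the predictor is $\hat\chi_{s_0}(t)=\sum_{i=1}^n\lambda_i(t)\chi_{s_i}(t)$, where the weight functions have the form $\lambda_i(t)=\mathbf{b}_i^{\intercal}\mathbf{B}_\lambda(t)$ and $\mathbf{b}_1,\ldots,\mathbf{b}_n\in\mathbb{R}^K$ are chosen to minimize $\mathrm{MISE}(s_0)$ subject to the unbiasedness constraint $\sum_{i=1}^n\lambda_i(t)=1$ for all $t\in T$ (imposed in the form $\sum_{i=1}^n\mathbf{b}_i=\mathbf{c}$). Ordinary kriging for functional data (OKFD): the predictor is $\hat\chi_{s_0}(t)=\sum_{i=1}^n\lambda_i\chi_{s_i}(t)$,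 where the real constants $\lambda_1,\ldots,\lambda_n$ are chosen to minimize $\mathrm{MISE}(s_0)$ subject to unbiasedness, $\sum_{i=1}^n\lambda_i=1$. Realizations of the random functions are assumed to be square integrable on $T$.
   Formalization: Optimal weights need not be unique (e.g. zero variogram); that all optimal PWFK weights are constant with b_i = λ_i c is proved when the optimum is unique; in general, constant optima exist, match the OKFD optima, and every PWFK optimum at each t gives OKFD-optimal weights. *)

theory Defs
  imports "HOL-Probability.Probability"
begin

definition covariance :: "'w measure \<Rightarrow> ('w \<Rightarrow> real) \<Rightarrow> ('w \<Rightarrow> real) \<Rightarrow> real" where
  "covariance M X Y =
     integral\<^sup>L M (\<lambda>\<omega>. (X \<omega> - integral\<^sup>L M X) * (Y \<omega> - integral\<^sup>L M Y))"

definition second_order_isotropic_stationary ::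
    "'w measure \<Rightarrow> (real ^ 2) set \<Rightarrow> (real ^ 2 \<Rightarrow> 'w \<Rightarrow> real) \<Rightarrow> bool" where
  "second_order_isotropic_stationary M D f \<longleftrightarrow>
     (\<forall>s\<in>D. f s \<in> borel_measurable M \<and> integrable M (\<lambda>\<omega>. (f s \<omega>)\<^sup>2)) \<and>
     (\<exists>m. \<forall>s\<in>D. integral\<^sup>L M (f s) = m) \<and>
     (\<exists>v. \<forall>s\<in>D. prob_space.variance M (f s) = v) \<and>
     (\<exists>C. \<forall>s\<in>D. \<forall>v\<in>D. covariance M (f s) (f v) = C (dist s v))"

text \<open>As usual in geostatistics, the variogram is \<open>2 * \<gamma>\<close>, not \<open>\<gamma>\<close>.\<close>

definition has_variogram ::
    "'w measure \<Rightarrow> (real ^ 2) set \<Rightarrow> (real ^ 2 \<Rightarrow> 'w \<Rightarrow> real) \<Rightarrow> (real \<Rightarrow> real) \<Rightarrow> bool" where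
  "has_variogram M D f \<gamma> \<longleftrightarrow>
     (\<forall>s\<in>D. \<forall>v\<in>D. prob_space.variance M (\<lambda>\<omega>. f s \<omega> - f v \<omega>) = 2 * \<gamma> (dist s v))"

text \<open>Independence of the components as random fields: each component is regarded as one
  random element of the product space of real functions on \<open>D\<close>.\<close>

definition independent_fields ::
    "'w measure \<Rightarrow> (real ^ 2) set \<Rightarrow> (real ^ 2 \<Rightarrow> 'w \<Rightarrow> real ^ 'q::finite) \<Rightarrow> bool" where
  "independent_fields M D r \<longleftrightarrow>
     prob_space.indep_vars M (\<lambda>j. \<Pi>\<^sub>M s\<in>D. (borel :: real measure))
       (\<lambda>j \<omega>. \<lambda>s\<in>D. r s \<omega> $ j) UNIV"

text \<open>A linear model of coregionalization \<open>a(s) = P r(s)\<close> whose \<open>q\<close> latent fields share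
  the variogram \<open>2 * \<gamma>\<close>.\<close>

definition linear_coregionalization ::
    "'w measure \<Rightarrow> (real ^ 2) set \<Rightarrow> real ^ 'q::finite ^ 'p::finite \<Rightarrow>
     (real ^ 2 \<Rightarrow> 'w \<Rightarrow> real ^ 'q) \<Rightarrow> (real \<Rightarrow> real) \<Rightarrow> (real ^ 2 \<Rightarrow> 'w \<Rightarrow> real ^ 'p) \<Rightarrow> bool" where
  "linear_coregionalization M D P r \<gamma> a \<longleftrightarrow>
     independent_fields M D r \<and>
     (\<forall>j. second_order_isotropic_stationary M D (\<lambda>s \<omega>. r s \<omega> $ j)) \<and>
     (\<forall>j. has_variogram M D (\<lambda>s \<omega>. r s \<omega> $ j) \<gamma>) \<and>
     (\<forall>s\<in>D. \<forall>\<omega>\<in>space M. a s \<omega> = P *v r s \<omega>)"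

definition square_integrable_on :: "real set \<Rightarrow> (real \<Rightarrow> real) \<Rightarrow> bool" where
  "square_integrable_on T f \<longleftrightarrow>
     set_borel_measurable lebesgue T f \<and> set_integrable lebesgue T (\<lambda>t. (f t)\<^sup>2)"

definition G_integrand ::
    "real ^ 'q::finite ^ 'p::finite \<Rightarrow> (real \<Rightarrow> real ^ 'p) \<Rightarrow> (real \<Rightarrow> real ^ 'k::finite) \<Rightarrow>
     'k \<Rightarrow> 'k \<Rightarrow> real \<Rightarrow> real" where
  "G_integrand P B B\<^sub>\<Lambda> k l t =
     (B t \<bullet> ((P ** transpose P) *v B t)) * (B\<^sub>\<Lambda> t $ k * B\<^sub>\<Lambda> t $ l)"

definition G_matrix ::
    "real set \<Rightarrow> real ^ 'q::finite ^ 'p::finite \<Rightarrow> (real \<Rightarrow> real ^ 'p) \<Rightarrow>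
     (real \<Rightarrow> real ^ 'k::finite) \<Rightarrow> real ^ 'k ^ 'k" where
  "G_matrix T P B B\<^sub>\<Lambda> = (\<chi> k l. LINT t:T|lebesgue. G_integrand P B B\<^sub>\<Lambda> k l t)"

text \<open>The mean integrated squared error is taken in the extended nonnegative reals: with the
  Bochner integral, a predictor of infinite error would get the value 0.\<close>

definition mise ::
    "'w measure \<Rightarrow> real set \<Rightarrow> ('w \<Rightarrow> real \<Rightarrow> real) \<Rightarrow> ('w \<Rightarrow> real \<Rightarrow> real) \<Rightarrow> ennreal" where
  "mise M T Yhat Y =
     (\<integral>\<^sup>+\<omega>. (\<integral>\<^sup>+t\<in>T. ennreal ((Yhat \<omega> t - Y \<omega> t)\<^sup>2) \<partial>lebesgue) \<partial>M)"

definition kriging_predictor ::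
    "(real ^ 2 \<Rightarrow> 'w \<Rightarrow> real \<Rightarrow> real) \<Rightarrow> ('n::finite \<Rightarrow> real ^ 2) \<Rightarrow> ('n \<Rightarrow> real \<Rightarrow> real) \<Rightarrow>
     'w \<Rightarrow> real \<Rightarrow> real" where
  "kriging_predictor X s w \<omega> t = (\<Sum>i\<in>UNIV. w i t * X (s i) \<omega> t)"

definition pwfk_weight ::
    "(real \<Rightarrow> real ^ 'k::finite) \<Rightarrow> ('n \<Rightarrow> real ^ 'k) \<Rightarrow> 'n \<Rightarrow> real \<Rightarrow> real" where
  "pwfk_weight B\<^sub>\<Lambda> b i t = b i \<bullet> B\<^sub>\<Lambda> t"

text \<open>The unbiasedness constraint \<open>(\<Sum>i. pwfk_weight B\<^sub>\<Lambda> b i t) = 1\<close> for \<open>t \<in> T\<close> is imposed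
  in the form \<open>(\<Sum>i. b i) = c\<close>, where \<open>c \<bullet> B\<^sub>\<Lambda> t = 1\<close> on \<open>T\<close>.\<close>

definition pwfk_optimal ::
    "'w measure \<Rightarrow> real set \<Rightarrow> (real ^ 2 \<Rightarrow> 'w \<Rightarrow> real \<Rightarrow> real) \<Rightarrow> ('n::finite \<Rightarrow> real ^ 2) \<Rightarrow>
     real ^ 2 \<Rightarrow> (real \<Rightarrow> real ^ 'k::finite) \<Rightarrow> real ^ 'k \<Rightarrow> ('n \<Rightarrow> real ^ 'k) \<Rightarrow> bool" where
  "pwfk_optimal M T X s s0 B\<^sub>\<Lambda> c b \<longleftrightarrow>
     is_arg_min (\<lambda>b. mise M T (kriging_predictor X s (pwfk_weight B\<^sub>\<Lambda> b)) (X s0))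
       (\<lambda>b. (\<Sum>i\<in>UNIV. b i) = c) b"

definition okfd_optimal ::
    "'w measure \<Rightarrow> real set \<Rightarrow> (real ^ 2 \<Rightarrow> 'w \<Rightarrow> real \<Rightarrow> real) \<Rightarrow> ('n::finite \<Rightarrow> real ^ 2) \<Rightarrow>
     real ^ 2 \<Rightarrow> ('n \<Rightarrow> real) \<Rightarrow> bool" where
  "okfd_optimal M T X s s0 lam \<longleftrightarrow>
     is_arg_min (\<lambda>lam. mise M T (kriging_predictor X s (\<lambda>i t. lam i)) (X s0))
       (\<lambda>lam. (\<Sum>i\<in>UNIV. lam i) = 1) lam"

end

theory Submission
  imports Defs
begin

text \<open>Let \<open>S\<close> be the covariance matrix of the increments \<open>r(s\<^sub>i) - r(s\<^sub>0)\<close> of one latent field; it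
  depends only on the common variogram. Under the unbiasedness constraint the prediction error is a
  combination of these increments, so independence and Tonelli turn the MISE of the weights
  \<open>b\<^sub>i \<bullet> B\<^sub>\<Lambda>(t)\<close> into \<open>F(b) = \<Sum>\<^sub>i\<^sub>j S\<^sub>i\<^sub>j b\<^sub>i \<bullet> G b\<^sub>j\<close>, where \<open>F \<ge> 0\<close>. As \<open>S\<close> is positive semidefinite there
  is \<open>x\<close> with \<open>\<Sum>\<^sub>i x\<^sub>i = 1\<close> and \<open>S x\<close> a multiple of the all-ones vector. Then \<open>b\<^sub>i = x\<^sub>i c\<close> is a critical
  point, \<open>F(b) = F(x c) + F(b - x c)\<close> on the constraint set, and, \<open>G\<close> being invertible,
  \<open>F(b - x c) = 0\<close> iff every coordinate of \<open>b - x c\<close> lies in the kernel of \<open>S\<close>. Constant weights are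
  the case \<open>b\<^sub>i = \<lambda>\<^sub>i c\<close>, so both optimization problems are governed by the same kernel.\<close>

section \<open>Linear algebra: positive semidefinite matrices\<close>

text \<open>The polynomial has its minimum 0 at t = 0, so its derivative there vanishes. This is the
  first-order condition behind both null-vector lemmas below.\<close>

lemma linear_quadratic_nonneg:
  fixes a b :: real
  assumes "\<And>t. 0 \<le> 2 * t * a + t\<^sup>2 * b"
  shows "a = 0"
proof (rule ccontr)
  assume "a \<noteq> 0"
  \<comment> \<open>The step t = -a/m gives the value a^2 (b - 2m)/m^2, negative as soon as 2m
    exceeds b; the summand 1 keeps m positive.\<close>
  define m where "m = 1 + \<bar>b\<bar>"
  have m: "0 < m" "b < 2 * m" by (auto simp: m_def)
  have "2 * (- a / m) * a + (- a / m)\<^sup>2 * b = a\<^sup>2 * (b - 2 * m) / m\<^sup>2"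
    using m(1) by (simp add: field_simps power2_eq_square)
  moreover have "a\<^sup>2 * (b - 2 * m) / m\<^sup>2 < 0"
    using m \<open>a \<noteq> 0\<close> by (simp add: divide_less_0_iff mult_less_0_iff)
  ultimately show False using assms[of "- a / m"] by linarith
qed

lemma inner_matrix_symmetric:
  fixes A :: "real ^ 'n ^ 'n"
  assumes "transpose A = A"
  shows "x \<bullet> (A *v y) = y \<bullet> (A *v x)"
  by (metis assms dot_lmul_matrix inner_commute vector_transpose_matrix)

text \<open>A null vector minimizes the quadratic form, so the linear term vanishes in every
  direction y; hence \<open>A *v x\<close> is orthogonal to everything.\<close>

lemma psd_matrix_null:
  fixes A :: "real ^ 'n ^ 'n"
  assumes sym: "transpose A = A" and psd: "\<And>x. 0 \<le> x \<bullet> (A *v x)" and null: "x \<bullet> (A *v x) = 0"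
  shows "A *v x = 0"
proof -
  have "y \<bullet> (A *v x) = 0" for y
  proof (rule linear_quadratic_nonneg)
    fix t :: real
    have "0 \<le> (x + t *\<^sub>R y) \<bullet> (A *v (x + t *\<^sub>R y))" by (rule psd)
    also have "\<dots> = 2 * t * (y \<bullet> (A *v x)) + t\<^sup>2 * (y \<bullet> (A *v y))"
      using null inner_matrix_symmetric[OF sym, of x y]
      by (simp add: matrix_vector_right_distrib matrix_vector_mult_scaleR inner_add_left
          inner_add_right power2_eq_square algebra_simps)
    finally show "0 \<le> 2 * t * (y \<bullet> (A *v x)) + t\<^sup>2 * (y \<bullet> (A *v y))" .
  qed
  then show ?thesis by (metis inner_eq_zero_iff)
qed

text \<open>Split the all-ones vector \<open>1\<close> into y in the range of S and z orthogonal to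
  it; by symmetry z lies in the kernel. If z is nonzero, a multiple of z works with \<mu> = 0.
  Otherwise \<open>1\<close> is itself some S x, which is rescaled.\<close>

lemma psd_affine_critical_point:
  fixes S :: "real ^ 'n ^ 'n"
  assumes sym: "transpose S = S" and psd: "\<And>x. 0 \<le> x \<bullet> (S *v x)"
  obtains x \<mu> where "x \<bullet> 1 = 1" "S *v x = \<mu> *\<^sub>R 1"
proof -
  define R where "R = range ((*v) S)"
  have "subspace R" unfolding R_def
    by (simp add: linear_subspace_image)
  obtain y z where y: "y \<in> span R" and z: "\<And>w. w \<in> span R \<Longrightarrow> orthogonal z w" and yz: "1 = y + z"
    using orthogonal_subspace_decomp_exists[of R 1] by blast
  have "w \<bullet> (S *v z) = 0" for w
    using z[of "S *v w"] inner_matrix_symmetric[OF sym, of w z]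
    by (simp add: R_def span_base orthogonal_def)
  then have Sz: "S *v z = 0" by (metis inner_eq_zero_iff)
  have z1: "z \<bullet> 1 = z \<bullet> z" 
    using z[OF y] arg_cong[OF yz, of "(\<bullet>) z"] by (simp add: orthogonal_def inner_add_right)
  show thesis
  proof (cases "z = 0")
    case False
    then show thesis
      using Sz z1 by (intro that[of "(1 / (z \<bullet> z)) *\<^sub>R z" 0]) (auto simp: matrix_vector_mult_scaleR)
  next
    case True
    then have "1 \<in> R" using y yz \<open>subspace R\<close> by (metis add.right_neutral span_eq_iff)
    then obtain x where x: "S *v x = 1" by (auto simp: R_def)
    \<comment> \<open>Here x \<bullet> 1 = x \<bullet> S x; were it zero, x would be a null vector
      and S x = 0, not \<open>1\<close>.\<close>
    have "x \<bullet> 1 \<noteq> 0"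
    proof
      assume "x \<bullet> 1 = 0"
      then have "S *v x = 0" using psd_matrix_null[OF sym psd] x by metis
      with x show False by simp
    qed
    then show thesis
      using x by (intro that[of "(1 / (x \<bullet> 1)) *\<^sub>R x" "1 / (x \<bullet> 1)"])
        (auto simp: matrix_vector_mult_scaleR)
  qed
qed

section \<open>The quadratic form of the kriging problem\<close>

text \<open>The form of the Kronecker product of S and G on n-tuples of coefficient vectors. Two
  arguments are kept so that cross terms can be named.\<close>

definition kriging_form ::
    "real ^ 'n ^ 'n \<Rightarrow> real ^ 'k ^ 'k \<Rightarrow> ('n::finite \<Rightarrow> real ^ 'k::finite) \<Rightarrow> ('n \<Rightarrow> real ^ 'k) \<Rightarrow> real" where
  "kriging_form S G b d = (\<Sum>i\<in>UNIV. \<Sum>j\<in>UNIV. S $ i $ j * (b i \<bullet> (G *v d j)))"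

lemma kriging_form_sym:
  assumes "transpose S = S" "transpose G = G"
  shows "kriging_form S G b d = kriging_form S G d b"
proof -
  have S: "S $ i $ j = S $ j $ i" for i j using assms(1) by (metis transpose_def vec_lambda_beta)
  show ?thesis unfolding kriging_form_def
    by (subst sum.swap, intro sum.cong refl)
      (simp add: S[of _ _] inner_matrix_symmetric[OF assms(2), of "d _"] S)
qed

lemma kriging_form_add_scaleR:
  assumes "transpose S = S" "transpose G = G"
  shows "kriging_form S G (\<lambda>i. b i + t *\<^sub>R d i) (\<lambda>i. b i + t *\<^sub>R d i) =
    kriging_form S G b b + 2 * t * kriging_form S G d b + t\<^sup>2 * kriging_form S G d d"
proof -
  have "kriging_form S G (\<lambda>i. b i + t *\<^sub>R d i) (\<lambda>i. b i + t *\<^sub>R d i) =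
    kriging_form S G b b + t * kriging_form S G b d + t * kriging_form S G d b + t\<^sup>2 * kriging_form S G d d"
    unfolding kriging_form_def
    by (simp add: matrix_vector_right_distrib matrix_vector_mult_scaleR inner_add_left
          inner_add_right power2_eq_square sum.distrib sum_distrib_left algebra_simps)
  then show ?thesis using kriging_form_sym[OF assms, of b d] by simp
qed

text \<open>Moving the sum over j inside G isolates S acting on the family b coordinatewise, the
  object in the kernel condition.\<close>

lemma kriging_form_eq_sum:
  "kriging_form S G d b = (\<Sum>i\<in>UNIV. d i \<bullet> (G *v (\<Sum>j\<in>UNIV. S $ i $ j *\<^sub>R b j)))"
  by (simp add: kriging_form_def matrix_vector_mult_scaleR inner_sum_right
      linear_sum[OF matrix_vector_mul_linear] o_def)

text \<open>As for a single matrix, a null family b minimizes the form, so all cross terms with b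
  vanish. Nonnegativity is a hypothesis because it is later read off from an integral.\<close>

lemma kriging_form_null_iff:
  assumes S: "transpose S = S" and G: "transpose G = G" "invertible G"
    and psd: "\<And>d. 0 \<le> kriging_form S G d d"
  shows "kriging_form S G b b = 0 \<longleftrightarrow> (\<forall>i. (\<Sum>j\<in>UNIV. S $ i $ j *\<^sub>R b j) = 0)"
proof
  assume null: "kriging_form S G b b = 0"
  let ?v = "\<lambda>i. G *v (\<Sum>j\<in>UNIV. S $ i $ j *\<^sub>R b j)"
  have "kriging_form S G d b = 0" for d
  proof (rule linear_quadratic_nonneg)
    show "0 \<le> 2 * t * kriging_form S G d b + t\<^sup>2 * kriging_form S G d d" for t
      using psd[of "\<lambda>i. b i + t *\<^sub>R d i"] null by (simp add: kriging_form_add_scaleR[OF S G(1)])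
  qed
  \<comment> \<open>Testing against d = G S b turns the cross term into a sum of squared norms;
    injectivity of G then removes G.\<close>
  from this[of ?v] have "(\<Sum>i\<in>UNIV. ?v i \<bullet> ?v i) = 0" by (simp add: kriging_form_eq_sum)
  then have "?v i = 0" for i by (simp add: sum_nonneg_eq_0_iff)
  then show "\<forall>i. (\<Sum>j\<in>UNIV. S $ i $ j *\<^sub>R b j) = 0"
    using inj_matrix_vector_mult[OF G(2)] by (metis injD matrix_vector_mult_0_right)
qed (simp add: kriging_form_eq_sum)

text \<open>S maps the family x_i c to the constant family \<mu> c, and the deviations b_i - x_i c
  sum to zero, so they are orthogonal to it in the form: a Pythagorean identity.\<close>

lemma kriging_form_critical:
  assumes S: "transpose S = S" and G: "transpose G = G"
    and x: "S *v x = \<mu> *\<^sub>R 1" "x \<bullet> 1 = 1"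
    and b: "(\<Sum>i\<in>UNIV. b i) = c"
  shows "kriging_form S G b b = kriging_form S G (\<lambda>i. x $ i *\<^sub>R c) (\<lambda>i. x $ i *\<^sub>R c) +
    kriging_form S G (\<lambda>i. b i - x $ i *\<^sub>R c) (\<lambda>i. b i - x $ i *\<^sub>R c)"
proof -
  let ?h = "\<lambda>i. b i - x $ i *\<^sub>R c"
  have "(\<Sum>j\<in>UNIV. S $ i $ j *\<^sub>R x $ j *\<^sub>R c) = \<mu> *\<^sub>R c" for i
  proof -
    have "(\<Sum>j\<in>UNIV. S $ i $ j *\<^sub>R x $ j *\<^sub>R c) = (S *v x) $ i *\<^sub>R c"
      by (simp add: matrix_vector_mult_def scaleR_sum_left)
    then show ?thesis by (simp add: x)
  qed
  then have "kriging_form S G ?h (\<lambda>i. x $ i *\<^sub>R c) = (\<Sum>i\<in>UNIV. ?h i) \<bullet> (G *v (\<mu> *\<^sub>R c))"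
    by (simp add: kriging_form_eq_sum inner_sum_left)
  also have "(\<Sum>i\<in>UNIV. ?h i) = 0"
    using x(2) b by (simp add: sum_subtractf inner_vec_def flip: scaleR_sum_left)
  finally have "kriging_form S G ?h (\<lambda>i. x $ i *\<^sub>R c) = 0" by simp
  then show ?thesis using kriging_form_add_scaleR[OF S G, of "\<lambda>i. x $ i *\<^sub>R c" 1 ?h] by simp
qed

section \<open>Minimizers and measure-theoretic preliminaries\<close>

text \<open>On the feasible set the objective is the minimum m plus an excess that vanishes at the
  feasible point y. Nonnegativity makes \<open>ennreal\<close> reflect the strict order.\<close>

lemma is_arg_min_excess:
  assumes "\<And>x. Q x \<Longrightarrow> f x = ennreal (m + g x)" and "0 \<le> m" and "\<And>x. 0 \<le> g x"
    and "Q y" and "g y = 0"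
  shows "is_arg_min f Q x \<longleftrightarrow> Q x \<and> g x = 0"
proof
  assume "is_arg_min f Q x"
  then have Q: "Q x" and "\<not> f y < f x" using assms(4) by (auto simp: is_arg_min_def)
  then have "\<not> m < m + g x" using assms(1,2,4,5) assms(3)[of x] by (simp add: ennreal_less_iff)
  then show "Q x \<and> g x = 0" using Q assms(3)[of x] by simp
next
  assume "Q x \<and> g x = 0"
  then show "is_arg_min f Q x"
    using assms(1,2,3) by (auto simp: is_arg_min_def ennreal_less_iff not_less)
qed

text \<open>A countable cover for \<open>lborel\<close> also serves for its completion. Needed for
  Tonelli over \<open>lebesgue\<close> and the probability space.\<close>

lemma sigma_finite_lebesgue: "sigma_finite_measure (lebesgue :: 'a::euclidean_space measure)"
proof
  obtain A :: "'a set set" where "countable A" "A \<subseteq> sets lborel" "\<Union>A = space lborel"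
    "\<forall>a\<in>A. emeasure lborel a \<noteq> \<infinity>"
    using lborel.sigma_finite_countable by blast
  then show "\<exists>A :: 'a set set. countable A \<and> A \<subseteq> sets lebesgue \<and> \<Union>A = space lebesgue \<and>
    (\<forall>a\<in>A. emeasure lebesgue a \<noteq> \<infinity>)"
    by (intro exI[of _ A]) (auto simp: subset_iff)
qed

lemma square_integrable_mult:
  fixes f g :: "'w \<Rightarrow> real"
  assumes "f \<in> borel_measurable M" "g \<in> borel_measurable M"
    and "integrable M (\<lambda>x. (f x)\<^sup>2)" "integrable M (\<lambda>x. (g x)\<^sup>2)"
  shows "integrable M (\<lambda>x. f x * g x)"
proof (rule Bochner_Integration.integrable_bound)
  show "integrable M (\<lambda>x. (f x)\<^sup>2 + (g x)\<^sup>2)" using assms by simp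
  show "(\<lambda>x. f x * g x) \<in> borel_measurable M" using assms by simp
  have "\<bar>u * v\<bar> \<le> u\<^sup>2 + v\<^sup>2" for u v :: real
  proof -
    have "2 * \<bar>u * v\<bar> \<le> u\<^sup>2 + v\<^sup>2"
      using sum_squares_bound[of "\<bar>u\<bar>" "\<bar>v\<bar>"] by (simp add: abs_mult)
    then show ?thesis by linarith
  qed
  then show "AE x in M. norm (f x * g x) \<le> norm ((f x)\<^sup>2 + (g x)\<^sup>2)" by simp
qed

section \<open>Second moments of the increments of the latent fields\<close>

text \<open>Written through \<gamma> alone, the matrix is visibly the same for every latent field.
  The factor 2 in the variogram cancels the 1/2 of polarization.\<close>

definition increment_covariance ::
    "(real \<Rightarrow> real) \<Rightarrow> (real ^ 2) \<Rightarrow> ('n::finite \<Rightarrow> real ^ 2) \<Rightarrow> real ^ 'n ^ 'n" where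
  "increment_covariance \<gamma> s0 s =
     (\<chi> i k. \<gamma> (dist (s i) s0) + \<gamma> (dist (s k) s0) - \<gamma> (dist (s i) (s k)))"

context prob_space
begin

lemma stationary_increments:
  assumes f: "second_order_isotropic_stationary M D f" and "u \<in> D" "v \<in> D"
  shows "(\<lambda>\<omega>. f u \<omega> - f v \<omega>) \<in> borel_measurable M"
    and "integrable M (\<lambda>\<omega>. (f u \<omega> - f v \<omega>)\<^sup>2)"
    and "integrable M (\<lambda>\<omega>. f u \<omega> - f v \<omega>)"
    and "expectation (\<lambda>\<omega>. f u \<omega> - f v \<omega>) = 0"
proof -
  have m[measurable]: "f u \<in> borel_measurable M" "f v \<in> borel_measurable M"
    and i: "integrable M (\<lambda>\<omega>. (f u \<omega>)\<^sup>2)" "integrable M (\<lambda>\<omega>. (f v \<omega>)\<^sup>2)"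
    and e: "expectation (f u) = expectation (f v)"
    using assms unfolding second_order_isotropic_stationary_def by auto
  have fi: "integrable M (f u)" "integrable M (f v)"
    using m i by (auto intro: square_integrable_imp_integrable)
  show "(\<lambda>\<omega>. f u \<omega> - f v \<omega>) \<in> borel_measurable M" by simp
  show "integrable M (\<lambda>\<omega>. (f u \<omega> - f v \<omega>)\<^sup>2)"
    using i square_integrable_mult[OF m i] by (simp add: power2_diff mult.assoc)
  show "integrable M (\<lambda>\<omega>. f u \<omega> - f v \<omega>)" "expectation (\<lambda>\<omega>. f u \<omega> - f v \<omega>) = 0"
    using fi e by simp_all
qed

lemma expectation_square_increment:
  assumes "second_order_isotropic_stationary M D f" "has_variogram M D f \<gamma>" "u \<in> D" "v \<in> D"
  shows "expectation (\<lambda>\<omega>. (f u \<omega> - f v \<omega>)\<^sup>2) = 2 * \<gamma> (dist u v)"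
  using assms(2)[unfolded has_variogram_def, rule_format, OF assms(3,4)]
    stationary_increments(4)[OF assms(1,3,4)] by simp

text \<open>Polarization: \<open>2xy = x\<^sup>2 + y\<^sup>2 - (x - y)\<^sup>2\<close>.\<close>

lemma expectation_mult_increments:
  assumes f: "second_order_isotropic_stationary M D f" "has_variogram M D f \<gamma>"
    and D: "u \<in> D" "v \<in> D" "w \<in> D"
  shows "expectation (\<lambda>\<omega>. (f u \<omega> - f w \<omega>) * (f v \<omega> - f w \<omega>)) =
    \<gamma> (dist u w) + \<gamma> (dist v w) - \<gamma> (dist u v)"
proof -
  have "expectation (\<lambda>\<omega>. (f u \<omega> - f w \<omega>) * (f v \<omega> - f w \<omega>)) =
    expectation (\<lambda>\<omega>. ((f u \<omega> - f w \<omega>)\<^sup>2 + (f v \<omega> - f w \<omega>)\<^sup>2 - (f u \<omega> - f v \<omega>)\<^sup>2) / 2)"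
    by (intro Bochner_Integration.integral_cong refl) (simp add: power2_eq_square algebra_simps)
  also have "\<dots> = (2 * \<gamma> (dist u w) + 2 * \<gamma> (dist v w) - 2 * \<gamma> (dist u v)) / 2"
    using stationary_increments(2)[OF f(1)] expectation_square_increment[OF f] D by simp
  finally show ?thesis by simp
qed

text \<open>Independence holds between whole fields, and an increment is a measurable function of
  one field, evaluated at two points of D.\<close>

lemma independent_fields_increments:
  fixes r :: "real ^ 2 \<Rightarrow> 'a \<Rightarrow> real ^ 'q::finite"
  assumes ind: "independent_fields M D r" and "j \<noteq> l" and D: "u \<in> D" "u' \<in> D" "v \<in> D" "v' \<in> D"
  shows "indep_var borel (\<lambda>\<omega>. r u \<omega> $ j - r u' \<omega> $ j) borel (\<lambda>\<omega>. r v \<omega> $ l - r v' \<omega> $ l)"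
proof -
  let ?N = "\<Pi>\<^sub>M s\<in>D. (borel :: real measure)"
  let ?R = "\<lambda>j \<omega>. \<lambda>s\<in>D. r s \<omega> $ j"
  \<comment> \<open>\<open>indep_var_restrict\<close> yields families indexed by singletons, so
    evaluation passes first through the index i and then through the location.\<close>
  have meas: "(\<lambda>x. x i a - x i b) \<in> borel_measurable (PiM {i} (\<lambda>_. ?N))"
    if "a \<in> D" "b \<in> D" for i :: 'q and a b
    by (intro borel_measurable_diff measurable_compose[OF measurable_component_singleton[of i "{i}"]
          measurable_component_singleton]) (use that in auto)
  have "indep_var (PiM {j} (\<lambda>_. ?N)) (\<lambda>\<omega>. \<lambda>i\<in>{j}. ?R i \<omega>) (PiM {l} (\<lambda>_. ?N)) (\<lambda>\<omega>. \<lambda>i\<in>{l}. ?R i \<omega>)"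
    using ind \<open>j \<noteq> l\<close> unfolding independent_fields_def by (intro indep_var_restrict) auto
  then have "indep_var borel ((\<lambda>x. x j u - x j u') \<circ> (\<lambda>\<omega>. \<lambda>i\<in>{j}. ?R i \<omega>))
      borel ((\<lambda>x. x l v - x l v') \<circ> (\<lambda>\<omega>. \<lambda>i\<in>{l}. ?R i \<omega>))"
    using D by (intro indep_var_compose[OF _ meas meas])
  then show ?thesis using D by (simp add: o_def)
qed

text \<open>Within one field this is polarization; across fields the expectation factorizes and the
  centred increments give 0.\<close>

lemma coregionalization_expectation_mult:
  assumes lc: "linear_coregionalization M D P r \<gamma> a" and D: "u \<in> D" "v \<in> D" "w \<in> D"
  shows "expectation (\<lambda>\<omega>. (r u \<omega> $ j - r w \<omega> $ j) * (r v \<omega> $ l - r w \<omega> $ l)) =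
    (if j = l then \<gamma> (dist u w) + \<gamma> (dist v w) - \<gamma> (dist u v) else 0)"
proof -
  have st: "second_order_isotropic_stationary M D (\<lambda>s \<omega>. r s \<omega> $ i)"
    and vg: "has_variogram M D (\<lambda>s \<omega>. r s \<omega> $ i) \<gamma>"
    and ind: "independent_fields M D r" for i
    using lc by (auto simp: linear_coregionalization_def)
  show ?thesis
  proof (cases "j = l")
    case True
    then show ?thesis using expectation_mult_increments[OF st vg D] by simp
  next
    case False
    then show ?thesis
      using indep_var_lebesgue_integral[OF independent_fields_increments[OF ind False D(1,3,2,3)]
          stationary_increments(3)[OF st D(1,3)] stationary_increments(3)[OF st D(2,3)]]
        stationary_increments(4)[OF st D(1,3)] by simp
  qed
qed

text \<open>After expanding the square, terms from different fields vanish and the remaining ones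
  share one covariance matrix. So |v|^2 factors out: the functional part separates from the spatial
  part.\<close>

lemma coregionalization_square_error:
  fixes s :: "'n::finite \<Rightarrow> real ^ 2" and v :: "real ^ 'q::finite"
  assumes lc: "linear_coregionalization M D P r \<gamma> a" and D: "range s \<subseteq> D" "s0 \<in> D"
  shows "integrable M (\<lambda>\<omega>. (\<Sum>i\<in>UNIV. w i * (v \<bullet> (r (s i) \<omega> - r s0 \<omega>)))\<^sup>2)" (is ?int)
    and "expectation (\<lambda>\<omega>. (\<Sum>i\<in>UNIV. w i * (v \<bullet> (r (s i) \<omega> - r s0 \<omega>)))\<^sup>2) =
      (v \<bullet> v) * (\<Sum>i\<in>UNIV. \<Sum>k\<in>UNIV. increment_covariance \<gamma> s0 s $ i $ k * (w i * w k))" (is ?eq)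
proof -
  let ?S = "increment_covariance \<gamma> s0 s"
  define d where "d i j \<omega> = r (s i) \<omega> $ j - r s0 \<omega> $ j" for i j \<omega>
  have st: "second_order_isotropic_stationary M D (\<lambda>s \<omega>. r s \<omega> $ j)" for j
    using lc by (auto simp: linear_coregionalization_def)
  have sD: "s i \<in> D" for i using D by auto
  have int: "integrable M (\<lambda>\<omega>. d i j \<omega> * d k l \<omega>)" for i j k l
    unfolding d_def by (intro square_integrable_mult stationary_increments[OF st] sD D(2))
  have exp: "expectation (\<lambda>\<omega>. d i j \<omega> * d k l \<omega>) = (if j = l then ?S $ i $ k else 0)" for i j k l
    unfolding d_def coregionalization_expectation_mult[OF lc sD sD D(2)]
    by (simp add: increment_covariance_def)
  have sq: "(\<Sum>i\<in>UNIV. w i * (v \<bullet> (r (s i) \<omega> - r s0 \<omega>)))\<^sup>2 =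
    (\<Sum>i\<in>UNIV. \<Sum>k\<in>UNIV. \<Sum>j\<in>UNIV. \<Sum>l\<in>UNIV. (w i * w k * v $ j * v $ l) * (d i j \<omega> * d k l \<omega>))" for \<omega>
  proof -
    have "v \<bullet> (r (s i) \<omega> - r s0 \<omega>) = (\<Sum>j\<in>UNIV. v $ j * d i j \<omega>)" for i
      by (simp add: inner_vec_def d_def)
    moreover have "(w i * (\<Sum>j\<in>UNIV. v $ j * d i j \<omega>)) * (w k * (\<Sum>j\<in>UNIV. v $ j * d k j \<omega>)) =
      (\<Sum>j\<in>UNIV. \<Sum>l\<in>UNIV. (w i * w k * v $ j * v $ l) * (d i j \<omega> * d k l \<omega>))" for i k
    proof -
      have "(w i * (\<Sum>j\<in>UNIV. v $ j * d i j \<omega>)) * (w k * (\<Sum>j\<in>UNIV. v $ j * d k j \<omega>)) =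
        w i * w k * ((\<Sum>j\<in>UNIV. v $ j * d i j \<omega>) * (\<Sum>j\<in>UNIV. v $ j * d k j \<omega>))"
        by (simp add: mult_ac)
      also have "\<dots> = w i * w k * (\<Sum>j\<in>UNIV. \<Sum>l\<in>UNIV. (v $ j * d i j \<omega>) * (v $ l * d k l \<omega>))"
        by (simp only: sum_product)
      finally show ?thesis by (simp add: sum_distrib_left mult_ac)
    qed
    ultimately show ?thesis by (simp add: power2_eq_square sum_product)
  qed
  show ?int unfolding sq using int by simp
  have "expectation (\<lambda>\<omega>. (\<Sum>i\<in>UNIV. w i * (v \<bullet> (r (s i) \<omega> - r s0 \<omega>)))\<^sup>2) =
    (\<Sum>i\<in>UNIV. \<Sum>k\<in>UNIV. \<Sum>j\<in>UNIV. \<Sum>l\<in>UNIV. (w i * w k * v $ j * v $ l) * (if j = l then ?S $ i $ k else 0))"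
    unfolding sq using int by (simp add: exp)
  also have "\<dots> = (\<Sum>i\<in>UNIV. \<Sum>k\<in>UNIV. \<Sum>j\<in>UNIV. (w i * w k * v $ j * v $ j) * ?S $ i $ k)"
    by (simp add: if_distrib[of "(*) _"] cong: if_cong)
  also have "\<dots> = (v \<bullet> v) * (\<Sum>i\<in>UNIV. \<Sum>k\<in>UNIV. ?S $ i $ k * (w i * w k))"
    by (simp add: inner_vec_def sum_distrib_left sum_distrib_right mult_ac)
  finally show ?eq .
qed

section \<open>The MISE as an integral over T\<close>

text \<open>Weights with sum 1 make the error a combination of increments tested against
  \<open>transpose P *v B t\<close>. Tonelli swaps the integrals, and the expected square is
  evaluated at each t.\<close>

lemma mise_kriging_predictor:
  fixes s :: "'n::finite \<Rightarrow> real ^ 2" and P :: "real ^ 'q::finite ^ 'p::finite"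
  assumes lc: "linear_coregionalization M D P r \<gamma> a" and D: "range s \<subseteq> D" "s0 \<in> D"
    and X: "\<And>u \<omega> t. u \<in> insert s0 (range s) \<Longrightarrow> \<omega> \<in> space M \<Longrightarrow> t \<in> T \<Longrightarrow> X u \<omega> t = a u \<omega> \<bullet> B t"
    and B: "set_borel_measurable lebesgue T B"
    and w: "\<And>i. set_borel_measurable lebesgue T (w i)"
    and w1: "\<And>t. t \<in> T \<Longrightarrow> (\<Sum>i\<in>UNIV. w i t) = 1"
  shows "mise M T (kriging_predictor X s w) (X s0) =
    (\<integral>\<^sup>+t\<in>T. ennreal ((B t \<bullet> ((P ** transpose P) *v B t)) *
      (\<Sum>i\<in>UNIV. \<Sum>k\<in>UNIV. increment_covariance \<gamma> s0 s $ i $ k * (w i t * w k t))) \<partial>lebesgue)"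
proof -
  define u where "u t = transpose P *v B t" for t
  \<comment> \<open>Cutting weights and basis off by the indicator of T gives functions measurable
    on the whole line and an error that vanishes outside T.\<close>
  define Z where "Z i t = indicator T t * w i t" for i t
  define V where "V t = indicator T t *\<^sub>R u t" for t
  define g where "g \<omega> t = (\<Sum>i\<in>UNIV. Z i t * (V t \<bullet> (r (s i) \<omega> - r s0 \<omega>)))" for \<omega> t
  have u: "B t \<bullet> (P *v x) = u t \<bullet> x" for t x
    by (simp add: u_def flip: dot_lmul_matrix)
  have uu: "B t \<bullet> ((P ** transpose P) *v B t) = u t \<bullet> u t" for t
    by (simp add: u flip: matrix_vector_mul_assoc) (simp add: u_def)
  have a: "a v \<omega> = P *v r v \<omega>" if "v \<in> D" "\<omega> \<in> space M" for v \<omega>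
    using lc that by (auto simp: linear_coregionalization_def)
  have error: "kriging_predictor X s w \<omega> t - X s0 \<omega> t = g \<omega> t" if "\<omega> \<in> space M" "t \<in> T" for \<omega> t
  proof -
    have x: "X v \<omega> t = u t \<bullet> r v \<omega>" if "v \<in> insert s0 (range s)" for v
      using X[OF that \<open>\<omega> \<in> space M\<close> \<open>t \<in> T\<close>] a[of v \<omega>] that D \<open>\<omega> \<in> space M\<close> u[of t]
      by (auto simp: inner_commute)
    \<comment> \<open>The term at s0 is multiplied by the sum of the weights, which is 1, so that it
      can be distributed over the increments.\<close>
    have "kriging_predictor X s w \<omega> t - X s0 \<omega> t =
      (\<Sum>i\<in>UNIV. w i t * (u t \<bullet> r (s i) \<omega>)) - (\<Sum>i\<in>UNIV. w i t) * (u t \<bullet> r s0 \<omega>)"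
      by (simp add: kriging_predictor_def x w1 that)
    also have "\<dots> = g \<omega> t"
      using that
      by (simp add: g_def Z_def V_def inner_diff_right right_diff_distrib sum_subtractf sum_distrib_right)
    finally show ?thesis .
  qed
  have error': "ennreal ((kriging_predictor X s w \<omega> t - X s0 \<omega> t)\<^sup>2) * indicator T t = ennreal ((g \<omega> t)\<^sup>2)"
    if "\<omega> \<in> space M" for \<omega> t
    using error[OF that, of t] by (cases "t \<in> T") (simp_all add: g_def Z_def)
  have Zm[measurable]: "Z i \<in> borel_measurable lebesgue" for i
    using w[of i] by (simp add: Z_def[abs_def] set_borel_measurable_def)
  have Vm[measurable]: "(\<lambda>t. V t $ j) \<in> borel_measurable lebesgue" for j
  proof -
    have "(\<lambda>t. (transpose P *v (indicator T t *\<^sub>R B t)) $ j) \<in> borel_measurable lebesgue"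
      using B unfolding set_borel_measurable_def
      by (rule measurable_compose)
        (intro borel_measurable_continuous_onI continuous_intros matrix_vector_mult_linear_continuous_on)
    then show ?thesis by (simp add: V_def u_def matrix_vector_mult_scaleR)
  qed
  have rm[measurable]: "(\<lambda>\<omega>. r v \<omega> $ j) \<in> borel_measurable M" if "v \<in> D" for v j
    using lc that by (auto simp: linear_coregionalization_def second_order_isotropic_stationary_def)
  have [measurable]: "(\<lambda>\<omega>. r s0 \<omega> $ j) \<in> borel_measurable M" "(\<lambda>\<omega>. r (s i) \<omega> $ j) \<in> borel_measurable M" for i j
    using D by (auto intro: rm)
  interpret pair_sigma_finite lebesgue M
    by (intro pair_sigma_finite.intro sigma_finite_lebesgue sigma_finite_measure_axioms)
  have "mise M T (kriging_predictor X s w) (X s0) = (\<integral>\<^sup>+\<omega>. (\<integral>\<^sup>+t. ennreal ((g \<omega> t)\<^sup>2) \<partial>lebesgue) \<partial>M)"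
    unfolding mise_def by (intro nn_integral_cong) (simp add: error')
  \<comment> \<open>\<open>g\<close> is a finite sum of products of a function of t and a function
    of \<omega>, hence jointly measurable.\<close>
  also have "\<dots> = (\<integral>\<^sup>+t. (\<integral>\<^sup>+\<omega>. ennreal ((g \<omega> t)\<^sup>2) \<partial>M) \<partial>lebesgue)"
    unfolding g_def inner_vec_def by (intro Fubini') simp
  also have "\<dots> = (\<integral>\<^sup>+t. ennreal ((V t \<bullet> V t) *
      (\<Sum>i\<in>UNIV. \<Sum>k\<in>UNIV. increment_covariance \<gamma> s0 s $ i $ k * (Z i t * Z k t))) \<partial>lebesgue)"
    unfolding g_def
    by (intro nn_integral_cong)
      (simp add: nn_integral_eq_integral coregionalization_square_error[OF lc D])
  also have "\<dots> = (\<integral>\<^sup>+t\<in>T. ennreal ((u t \<bullet> u t) *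
      (\<Sum>i\<in>UNIV. \<Sum>k\<in>UNIV. increment_covariance \<gamma> s0 s $ i $ k * (w i t * w k t))) \<partial>lebesgue)"
    by (intro nn_integral_cong) (auto simp: V_def Z_def indicator_def)
  finally show ?thesis by (simp add: uu)
qed

end

section \<open>Positivity, and the matrix G as an integral\<close>

lemma inner_matrix_vector_mult:
  fixes A :: "real ^ 'm ^ 'n"
  shows "x \<bullet> (A *v y) = (\<Sum>i\<in>UNIV. \<Sum>j\<in>UNIV. A $ i $ j * (x $ i * y $ j))"
  by (simp add: inner_vec_def matrix_vector_mult_def sum_distrib_left mult_ac)

lemma transpose_increment_covariance: "transpose (increment_covariance \<gamma> s0 s) = increment_covariance \<gamma> s0 s"
  by (simp add: increment_covariance_def transpose_def vec_eq_iff dist_commute)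

lemma (in prob_space) increment_covariance_nonneg:
  assumes lc: "linear_coregionalization M D P r \<gamma> a" and D: "range s \<subseteq> D" "s0 \<in> D"
  shows "0 \<le> x \<bullet> (increment_covariance \<gamma> s0 s *v x)"
proof -
  \<comment> \<open>The form is an expected square: take v to be a unit vector. Any latent field
    will do, so \<open>undefined\<close> picks the coordinate.\<close>
  have "x \<bullet> (increment_covariance \<gamma> s0 s *v x) =
    expectation (\<lambda>\<omega>. (\<Sum>i\<in>UNIV. x $ i * (axis undefined 1 \<bullet> (r (s i) \<omega> - r s0 \<omega>)))\<^sup>2)"
    by (simp add: coregionalization_square_error[OF lc D] inner_matrix_vector_mult inner_axis_axis)
  then show ?thesis by simp
qed

lemma inner_mult_transpose_nonneg: "0 \<le> x \<bullet> ((P ** transpose P) *v x)"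
  for P :: "real ^ 'q ^ 'p"
proof -
  have "x \<bullet> ((P ** transpose P) *v x) = (transpose P *v x) \<bullet> (transpose P *v x)"
    by (simp add: dot_lmul_matrix flip: matrix_vector_mul_assoc)
  then show ?thesis by simp
qed

lemma transpose_G_matrix: "transpose (G_matrix T P B B\<^sub>\<Lambda>) = G_matrix T P B B\<^sub>\<Lambda>"
  by (simp add: G_matrix_def G_integrand_def transpose_def vec_eq_iff mult_ac)

context
  fixes T :: "real set" and P :: "real ^ 'q::finite ^ 'p::finite" and B :: "real \<Rightarrow> real ^ 'p"
    and B\<^sub>\<Lambda> :: "real \<Rightarrow> real ^ 'k::finite"
  assumes G_integrable: "\<forall>k l. set_integrable lebesgue T (G_integrand P B B\<^sub>\<Lambda> k l)"
begin

text \<open>The integrand is a finite combination of the integrands of the entries of G.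
  Integrability of each entry lets the integral pass through the sums and rules out the default
  value 0.\<close>

lemma inner_G_matrix:
  shows "set_integrable lebesgue T
      (\<lambda>t. (B t \<bullet> ((P ** transpose P) *v B t)) * ((x \<bullet> B\<^sub>\<Lambda> t) * (y \<bullet> B\<^sub>\<Lambda> t)))" (is "set_integrable _ _ ?f")
    and "x \<bullet> (G_matrix T P B B\<^sub>\<Lambda> *v y) =
      (LINT t:T|lebesgue. (B t \<bullet> ((P ** transpose P) *v B t)) * ((x \<bullet> B\<^sub>\<Lambda> t) * (y \<bullet> B\<^sub>\<Lambda> t)))"
proof -
  have f: "indicator T t *\<^sub>R ?f t =
    (\<Sum>k\<in>UNIV. \<Sum>l\<in>UNIV. (indicator T t *\<^sub>R G_integrand P B B\<^sub>\<Lambda> k l t) * (x $ k * y $ l))" for t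
  proof -
    have "(x \<bullet> B\<^sub>\<Lambda> t) * (y \<bullet> B\<^sub>\<Lambda> t) = (\<Sum>k\<in>UNIV. \<Sum>l\<in>UNIV. (x $ k * B\<^sub>\<Lambda> t $ k) * (y $ l * B\<^sub>\<Lambda> t $ l))"
      by (simp add: inner_vec_def sum_product)
    then show ?thesis by (simp add: G_integrand_def sum_distrib_left mult_ac)
  qed
  have G: "integrable lebesgue (\<lambda>t. indicator T t *\<^sub>R G_integrand P B B\<^sub>\<Lambda> k l t)" for k l
    using G_integrable by (simp add: set_integrable_def)
  show "set_integrable lebesgue T ?f"
    unfolding set_integrable_def f by (intro Bochner_Integration.integrable_sum integrable_mult_left G)
  show "x \<bullet> (G_matrix T P B B\<^sub>\<Lambda> *v y) = (LINT t:T|lebesgue. ?f t)"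
    unfolding set_lebesgue_integral_def f
    by (subst Bochner_Integration.integral_sum,
        (intro Bochner_Integration.integrable_sum integrable_mult_left G)+)+
      (simp add: inner_matrix_vector_mult G_matrix_def set_lebesgue_integral_def G del: real_scaleR_def mult_scaleR_left)
qed

text \<open>The integrand is pointwise nonnegative, a squared norm times the form of S at the weight
  vector. Hence its Bochner and extended integrals agree, and the form is nonnegative.\<close>

lemma kriging_form_G_matrix:
  fixes S :: "real ^ 'n ^ 'n"
  assumes psd: "\<And>x. 0 \<le> x \<bullet> (S *v x)"
  shows "0 \<le> kriging_form S (G_matrix T P B B\<^sub>\<Lambda>) b b"
    and "(\<integral>\<^sup>+t\<in>T. ennreal ((B t \<bullet> ((P ** transpose P) *v B t)) *
      (\<Sum>i\<in>UNIV. \<Sum>j\<in>UNIV. S $ i $ j * ((b i \<bullet> B\<^sub>\<Lambda> t) * (b j \<bullet> B\<^sub>\<Lambda> t)))) \<partial>lebesgue) =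
      ennreal (kriging_form S (G_matrix T P B B\<^sub>\<Lambda>) b b)"
proof -
  let ?W = "\<lambda>t. B t \<bullet> ((P ** transpose P) *v B t)"
  define f where "f t = ?W t * (\<Sum>i\<in>UNIV. \<Sum>j\<in>UNIV. S $ i $ j * ((b i \<bullet> B\<^sub>\<Lambda> t) * (b j \<bullet> B\<^sub>\<Lambda> t)))" for t
  have f0: "0 \<le> f t" for t
    using psd[of "\<chi> i. b i \<bullet> B\<^sub>\<Lambda> t"] unfolding f_def
    by (intro mult_nonneg_nonneg inner_mult_transpose_nonneg) (simp add: inner_matrix_vector_mult)
  have f: "indicator T t *\<^sub>R f t = (\<Sum>i\<in>UNIV. \<Sum>j\<in>UNIV. S $ i $ j *
      (indicator T t *\<^sub>R (?W t * ((b i \<bullet> B\<^sub>\<Lambda> t) * (b j \<bullet> B\<^sub>\<Lambda> t)))))" for t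
    by (simp add: f_def sum_distrib_left mult_ac)
  have i: "integrable lebesgue (\<lambda>t. indicator T t *\<^sub>R (?W t * ((x \<bullet> B\<^sub>\<Lambda> t) * (y \<bullet> B\<^sub>\<Lambda> t))))" for x y
    using inner_G_matrix(1) by (simp add: set_integrable_def)
  have int: "integrable lebesgue (\<lambda>t. indicator T t *\<^sub>R f t)"
    unfolding f by (intro Bochner_Integration.integrable_sum integrable_mult_right i)
  have eq: "(LINT t|lebesgue. indicator T t *\<^sub>R f t) = kriging_form S (G_matrix T P B B\<^sub>\<Lambda>) b b"
    unfolding f
    by (subst Bochner_Integration.integral_sum,
        (intro Bochner_Integration.integrable_sum integrable_mult_right i)+)+
      (simp add: kriging_form_def inner_G_matrix(2) set_lebesgue_integral_def i
        del: real_scaleR_def mult_scaleR_right)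
  show "0 \<le> kriging_form S (G_matrix T P B B\<^sub>\<Lambda>) b b"
    unfolding eq[symmetric] using f0 by simp
  have "(\<integral>\<^sup>+t\<in>T. ennreal (f t) \<partial>lebesgue) = (\<integral>\<^sup>+t. ennreal (indicator T t *\<^sub>R f t) \<partial>lebesgue)"
    by (intro nn_integral_cong) (auto simp: indicator_def)
  also have "\<dots> = ennreal (kriging_form S (G_matrix T P B B\<^sub>\<Lambda>) b b)"
    using f0 unfolding eq[symmetric] by (intro nn_integral_eq_integral int) simp
  finally show "(\<integral>\<^sup>+t\<in>T. ennreal (?W t * (\<Sum>i\<in>UNIV. \<Sum>j\<in>UNIV. S $ i $ j *
      ((b i \<bullet> B\<^sub>\<Lambda> t) * (b j \<bullet> B\<^sub>\<Lambda> t)))) \<partial>lebesgue) = ennreal (kriging_form S (G_matrix T P B B\<^sub>\<Lambda>) b b)"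
    by (simp add: f_def)
qed

end

section \<open>Kernel characterization of the optimal weights\<close>

text \<open>Both minimizations share the minimum F(x c), and the excess is F of the deviation from x
  c, which is zero exactly on the kernel of S. What remains afterwards is pure linear
  algebra.\<close>

lemma kriging_optimal_iff:
  fixes M :: "'w measure" and s :: "'n::finite \<Rightarrow> real ^ 2" and P :: "real ^ 'q::finite ^ 'p::finite"
    and B\<^sub>\<Lambda> :: "real \<Rightarrow> real ^ 'k::finite"
  assumes M: "prob_space M"
    and X: "\<forall>u \<in> insert s0 (range s). \<forall>\<omega>\<in>space M. \<forall>t\<in>T. X u \<omega> t = a u \<omega> \<bullet> B t"
    and D: "range s \<subseteq> D" "s0 \<in> D"
    and lc: "linear_coregionalization M D P r \<gamma> a"
    and B: "set_borel_measurable lebesgue T B"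
    and B\<^sub>\<Lambda>: "set_borel_measurable lebesgue T B\<^sub>\<Lambda>"
    and c: "\<forall>t\<in>T. c \<bullet> B\<^sub>\<Lambda> t = 1"
    and G: "\<forall>k l. set_integrable lebesgue T (G_integrand P B B\<^sub>\<Lambda> k l)"
    and inv: "invertible (G_matrix T P B B\<^sub>\<Lambda>)"
  obtains x :: "'n \<Rightarrow> real" and S :: "real ^ 'n ^ 'n"
  where "(\<Sum>i\<in>UNIV. x i) = 1"
    and "\<And>b. pwfk_optimal M T X s s0 B\<^sub>\<Lambda> c b \<longleftrightarrow>
      (\<Sum>i\<in>UNIV. b i) = c \<and> (\<forall>i. (\<Sum>j\<in>UNIV. S $ i $ j *\<^sub>R (b j - x j *\<^sub>R c)) = 0)"
    and "\<And>lam. okfd_optimal M T X s s0 lam \<longleftrightarrow>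
      (\<Sum>i\<in>UNIV. lam i) = 1 \<and> (\<forall>i. (\<Sum>j\<in>UNIV. S $ i $ j *\<^sub>R (lam j *\<^sub>R c - x j *\<^sub>R c)) = 0)"
proof -
  interpret prob_space M by (rule M)
  define S where "S = increment_covariance \<gamma> s0 s"
  let ?G = "G_matrix T P B B\<^sub>\<Lambda>"
  have S: "transpose S = S" by (simp add: S_def transpose_increment_covariance)
  have psd: "0 \<le> y \<bullet> (S *v y)" for y
    unfolding S_def by (rule increment_covariance_nonneg[OF lc D])
  obtain x \<mu> where x: "x \<bullet> 1 = 1" "S *v x = \<mu> *\<^sub>R 1"
    using psd_affine_critical_point[OF S psd] .
  define F where "F b = kriging_form S ?G b b" for b
  have F0: "0 \<le> F b" for b unfolding F_def by (rule kriging_form_G_matrix(1)[OF G psd])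
  have F_null: "F b = 0 \<longleftrightarrow> (\<forall>i. (\<Sum>j\<in>UNIV. S $ i $ j *\<^sub>R b j) = 0)" for b
    unfolding F_def
    by (intro kriging_form_null_iff[OF S transpose_G_matrix inv] kriging_form_G_matrix(1)[OF G psd])
  have x1: "(\<Sum>i\<in>UNIV. x $ i) = 1" using x(1) by (simp add: inner_vec_def)
  have xc: "(\<Sum>i\<in>UNIV. x $ i *\<^sub>R c) = c" by (simp add: x1 flip: scaleR_sum_left)
  have meas: "set_borel_measurable lebesgue T (pwfk_weight B\<^sub>\<Lambda> b i)" for b :: "'n \<Rightarrow> real ^ 'k" and i
  proof -
    have "(\<lambda>t. b i \<bullet> (indicator T t *\<^sub>R B\<^sub>\<Lambda> t)) \<in> borel_measurable lebesgue"
      using B\<^sub>\<Lambda> by (intro borel_measurable_inner) (auto simp: set_borel_measurable_def)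
    then show ?thesis by (simp add: set_borel_measurable_def pwfk_weight_def)
  qed
  have mise_pwfk: "mise M T (kriging_predictor X s (pwfk_weight B\<^sub>\<Lambda> b)) (X s0) =
      ennreal (F (\<lambda>i. x $ i *\<^sub>R c) + F (\<lambda>i. b i - x $ i *\<^sub>R c))"
    if b: "(\<Sum>i\<in>UNIV. b i) = c" for b
  proof -
    have "(\<Sum>i\<in>UNIV. pwfk_weight B\<^sub>\<Lambda> b i t) = 1" if "t \<in> T" for t
      using b c that by (simp add: pwfk_weight_def flip: inner_sum_left)
    then have "mise M T (kriging_predictor X s (pwfk_weight B\<^sub>\<Lambda> b)) (X s0) = ennreal (F b)"
      using X kriging_form_G_matrix(2)[OF G psd, of b]
      by (subst mise_kriging_predictor[OF lc D _ B meas]) (auto simp: S_def F_def pwfk_weight_def)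
    then show ?thesis
      using kriging_form_critical[OF S transpose_G_matrix[of T P B B\<^sub>\<Lambda>] x(2,1) b]
      by (simp only: F_def)
  qed
  \<comment> \<open>On T the coefficients \<open>lam i *\<^sub>R c\<close> give the constant weight
    \<open>lam i\<close>, since c \<bullet> \<open>B\<^sub>\<Lambda> t\<close> = 1.\<close>
  have mise_okfd: "mise M T (kriging_predictor X s (\<lambda>i t. lam i)) (X s0) =
      mise M T (kriging_predictor X s (pwfk_weight B\<^sub>\<Lambda> (\<lambda>i. lam i *\<^sub>R c))) (X s0)" for lam
    unfolding mise_def using c
    by (intro nn_integral_cong) (auto simp: kriging_predictor_def pwfk_weight_def indicator_def)
  show thesis
  proof
    show "(\<Sum>i\<in>UNIV. x $ i) = 1" by (rule x1)
    show "pwfk_optimal M T X s s0 B\<^sub>\<Lambda> c b \<longleftrightarrow> (\<Sum>i\<in>UNIV. b i) = c \<and>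
      (\<forall>i. (\<Sum>j\<in>UNIV. S $ i $ j *\<^sub>R (b j - x $ j *\<^sub>R c)) = 0)" for b
      unfolding pwfk_optimal_def F_null[symmetric]
      by (rule is_arg_min_excess[where Q = "\<lambda>b. (\<Sum>i\<in>UNIV. b i) = c" and x = b
            and y = "\<lambda>i. x $ i *\<^sub>R c" and m = "F (\<lambda>i. x $ i *\<^sub>R c)"
            and g = "\<lambda>b. F (\<lambda>j. b j - x $ j *\<^sub>R c)"])
        (simp_all add: mise_pwfk F0 xc, simp add: F_null)
    show "okfd_optimal M T X s s0 lam \<longleftrightarrow> (\<Sum>i\<in>UNIV. lam i) = 1 \<and>
      (\<forall>i. (\<Sum>j\<in>UNIV. S $ i $ j *\<^sub>R (lam j *\<^sub>R c - x $ j *\<^sub>R c)) = 0)" for lam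
      unfolding okfd_optimal_def F_null[symmetric]
      by (rule is_arg_min_excess[where Q = "\<lambda>lam. (\<Sum>i\<in>UNIV. lam i) = 1" and x = lam
            and y = "($) x" and m = "F (\<lambda>i. x $ i *\<^sub>R c)"
            and g = "\<lambda>lam. F (\<lambda>j. lam j *\<^sub>R c - x $ j *\<^sub>R c)"])
        (simp_all add: mise_okfd mise_pwfk F0 x1 flip: scaleR_sum_left, simp add: F_null)
  qed
qed

section \<open>Comparison of the optimal weights of PWFK and OKFD\<close>

text \<open>If S kills some nonzero h with entries summing to 0, then x_i c + h_i e is PWFK-optimal
  for every vector e, and its weights may vary with t. Constancy is therefore claimed for unique
  optima; in general the weights at each t are OKFD-optimal.\<close>

theorem proposition3p1:
  fixes M :: "'w measure"
    and T :: "real set"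
    and D :: "(real ^ 2) set"
    and s :: "'n::finite \<Rightarrow> real ^ 2"
    and s0 :: "real ^ 2"
    and X :: "real ^ 2 \<Rightarrow> 'w \<Rightarrow> real \<Rightarrow> real"
    and a :: "real ^ 2 \<Rightarrow> 'w \<Rightarrow> real ^ 'p::finite"
    and r :: "real ^ 2 \<Rightarrow> 'w \<Rightarrow> real ^ 'q::finite"
    and P :: "real ^ 'q ^ 'p"
    and \<gamma> :: "real \<Rightarrow> real"
    and B :: "real \<Rightarrow> real ^ 'p"
    and B\<^sub>\<Lambda> :: "real \<Rightarrow> real ^ 'k::finite"
    and c :: "real ^ 'k"
  assumes "prob_space M"
    and "compact T"
    and "inj s" and "range s \<subseteq> D"
    and "s0 \<in> D" and "s0 \<notin> range s"
    and "\<forall>u \<in> insert s0 (range s). \<forall>\<omega>\<in>space M. \<forall>t\<in>T. X u \<omega> t = a u \<omega> \<bullet> B t"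
    and "\<forall>u \<in> insert s0 (range s). \<forall>\<omega>\<in>space M. square_integrable_on T (X u \<omega>)"
    and "linear_coregionalization M D P r \<gamma> a"
    and "set_borel_measurable lebesgue T B"
    and "set_borel_measurable lebesgue T B\<^sub>\<Lambda>"
    and "\<forall>t\<in>T. c \<bullet> B\<^sub>\<Lambda> t = 1"
    and "\<forall>k l. set_integrable lebesgue T (G_integrand P B B\<^sub>\<Lambda> k l)"
    and "invertible (G_matrix T P B B\<^sub>\<Lambda>)"
  shows "(\<exists>lam. okfd_optimal M T X s s0 lam) \<and>
    (\<forall>lam. okfd_optimal M T X s s0 lam \<longleftrightarrow>
       pwfk_optimal M T X s s0 B\<^sub>\<Lambda> c (\<lambda>i. lam i *\<^sub>R c)) \<and>
    (\<forall>b. pwfk_optimal M T X s s0 B\<^sub>\<Lambda> c b \<longrightarrow>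
       (\<forall>t\<in>T. okfd_optimal M T X s s0 (\<lambda>i. pwfk_weight B\<^sub>\<Lambda> b i t))) \<and>
    ((\<exists>!b. pwfk_optimal M T X s s0 B\<^sub>\<Lambda> c b) \<longleftrightarrow> (\<exists>!lam. okfd_optimal M T X s s0 lam)) \<and>
    ((\<exists>!b. pwfk_optimal M T X s s0 B\<^sub>\<Lambda> c b) \<longrightarrow>
       (\<forall>b. pwfk_optimal M T X s s0 B\<^sub>\<Lambda> c b \<longrightarrow>
         (\<exists>lam. okfd_optimal M T X s s0 lam \<and>
           (\<forall>i. b i = lam i *\<^sub>R c \<and> (\<forall>t\<in>T. pwfk_weight B\<^sub>\<Lambda> b i t = lam i)))))"
proof -
  obtain x :: "'n \<Rightarrow> real" and S :: "real ^ 'n ^ 'n" where x1: "(\<Sum>i\<in>UNIV. x i) = 1"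
    and pw: "\<And>b. pwfk_optimal M T X s s0 B\<^sub>\<Lambda> c b \<longleftrightarrow>
      (\<Sum>i\<in>UNIV. b i) = c \<and> (\<forall>i. (\<Sum>j\<in>UNIV. S $ i $ j *\<^sub>R (b j - x j *\<^sub>R c)) = 0)"
    and ok: "\<And>lam. okfd_optimal M T X s s0 lam \<longleftrightarrow>
      (\<Sum>i\<in>UNIV. lam i) = 1 \<and> (\<forall>i. (\<Sum>j\<in>UNIV. S $ i $ j *\<^sub>R (lam j *\<^sub>R c - x j *\<^sub>R c)) = 0)"
    by (rule kriging_optimal_iff[OF assms(1,7,4,5,9-14)]) blast
  \<comment> \<open>Over an empty T the matrix G would be zero, hence not invertible. A point of T
    then forces c to be nonzero.\<close>
  have "T \<noteq> {}"
  proof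
    assume "T = {}"
    then have "G_matrix T P B B\<^sub>\<Lambda> = 0"
      by (simp add: G_matrix_def set_lebesgue_integral_def vec_eq_iff)
    then have "G_matrix T P B B\<^sub>\<Lambda> *v 1 = G_matrix T P B B\<^sub>\<Lambda> *v 0" by simp
    then have "(1 :: real ^ 'k) = 0" using inj_matrix_vector_mult[OF assms(14)] by (metis injD)
    then show False by simp
  qed
  then have c0: "c \<noteq> 0" using assms(12) by auto
  \<comment> \<open>Cancelling the nonzero c turns the vector kernel condition into a scalar
    one.\<close>
  have ok': "okfd_optimal M T X s s0 lam \<longleftrightarrow>
    (\<Sum>i\<in>UNIV. lam i) = 1 \<and> (\<forall>i. (\<Sum>j\<in>UNIV. S $ i $ j * (lam j - x j)) = 0)" for lam
    using c0 by (simp add: ok flip: scaleR_left_diff_distrib scaleR_sum_left)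
  have ok_pw: "okfd_optimal M T X s s0 lam \<longleftrightarrow> pwfk_optimal M T X s s0 B\<^sub>\<Lambda> c (\<lambda>i. lam i *\<^sub>R c)" for lam
  proof -
    have "(\<Sum>i\<in>UNIV. lam i *\<^sub>R c) = c \<longleftrightarrow> (\<Sum>i\<in>UNIV. lam i) = 1"
      using c0 scaleR_cancel_right[of "\<Sum>i\<in>UNIV. lam i" c 1] by (simp flip: scaleR_sum_left)
    then show ?thesis by (simp add: ok pw)
  qed
  have ok_x: "okfd_optimal M T X s s0 x" by (simp add: ok x1)
  \<comment> \<open>Pairing the deviations b_i - x_i c with a fixed u gives a scalar kernel vector
    of S with sum 0; adding it to x stays among the OKFD optima.\<close>
  have direction: "okfd_optimal M T X s s0 (\<lambda>i. x i + (b i - x i *\<^sub>R c) \<bullet> u)"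
    if b: "pwfk_optimal M T X s s0 B\<^sub>\<Lambda> c b" for b u
  proof -
    have "(\<Sum>i\<in>UNIV. (b i - x i *\<^sub>R c) \<bullet> u) = ((\<Sum>i\<in>UNIV. b i) - (\<Sum>i\<in>UNIV. x i) *\<^sub>R c) \<bullet> u"
      by (simp add: inner_sum_left inner_diff_left sum_subtractf sum_distrib_right)
    also have "\<dots> = 0" using b x1 by (simp add: pw)
    finally have "(\<Sum>i\<in>UNIV. (b i - x i *\<^sub>R c) \<bullet> u) = 0" .
    moreover have "(\<Sum>j\<in>UNIV. S $ i $ j * ((b j - x j *\<^sub>R c) \<bullet> u)) = 0" for i
    proof -
      have "(\<Sum>j\<in>UNIV. S $ i $ j * ((b j - x j *\<^sub>R c) \<bullet> u)) =
        (\<Sum>j\<in>UNIV. S $ i $ j *\<^sub>R (b j - x j *\<^sub>R c)) \<bullet> u"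
        by (simp add: inner_sum_left)
      then show ?thesis using b by (simp add: pw)
    qed
    ultimately show ?thesis by (simp add: ok' sum.distrib x1)
  qed
  \<comment> \<open>With u = \<open>B\<^sub>\<Lambda> t\<close> the terms in x cancel, because c
    \<bullet> u = 1.\<close>
  have weights: "okfd_optimal M T X s s0 (\<lambda>i. pwfk_weight B\<^sub>\<Lambda> b i t)"
    if "pwfk_optimal M T X s s0 B\<^sub>\<Lambda> c b" "t \<in> T" for b t
    using direction[OF that(1), of "B\<^sub>\<Lambda> t"] assms(12) that(2)
    by (simp add: pwfk_weight_def inner_diff_left)
  \<comment> \<open>If x is the only OKFD optimum, the deviations are orthogonal to every u and so
    vanish.\<close>
  have unique_b: "b = (\<lambda>i. x i *\<^sub>R c)"
    if "\<exists>!lam. okfd_optimal M T X s s0 lam" "pwfk_optimal M T X s s0 B\<^sub>\<Lambda> c b" for b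
  proof
    fix i
    have "(\<lambda>i. x i + (b i - x i *\<^sub>R c) \<bullet> u) = x" for u
      using that(1) direction[OF that(2), of u] ok_x by blast
    then have "(b i - x i *\<^sub>R c) \<bullet> u = 0" for u by (simp add: fun_eq_iff)
    then have "b i - x i *\<^sub>R c = 0" by (metis inner_eq_zero_iff)
    then show "b i = x i *\<^sub>R c" by simp
  qed
  \<comment> \<open>The map sending lam to lam c takes OKFD optima to PWFK optima and is injective
    as c is nonzero.\<close>
  have unique_lam: "\<exists>!lam. okfd_optimal M T X s s0 lam" if u: "\<exists>!b. pwfk_optimal M T X s s0 B\<^sub>\<Lambda> c b"
  proof (rule ex1I[of _ x])
    fix lam assume "okfd_optimal M T X s s0 lam"
    then have "(\<lambda>i. lam i *\<^sub>R c) = (\<lambda>i. x i *\<^sub>R c)" using u ok_x ok_pw by blast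
    then show "lam = x" using c0 by (simp add: fun_eq_iff)
  qed (rule ok_x)
  have ex1_iff: "(\<exists>!b. pwfk_optimal M T X s s0 B\<^sub>\<Lambda> c b) \<longleftrightarrow> (\<exists>!lam. okfd_optimal M T X s s0 lam)"
  proof
    assume u: "\<exists>!lam. okfd_optimal M T X s s0 lam"
    show "\<exists>!b. pwfk_optimal M T X s s0 B\<^sub>\<Lambda> c b"
    proof (rule ex1I)
      show "pwfk_optimal M T X s s0 B\<^sub>\<Lambda> c (\<lambda>i. x i *\<^sub>R c)" using ok_x by (simp only: ok_pw)
    qed (rule unique_b[OF u])
  qed (rule unique_lam)
  have const_weights: "\<exists>lam. okfd_optimal M T X s s0 lam \<and>
      (\<forall>i. b i = lam i *\<^sub>R c \<and> (\<forall>t\<in>T. pwfk_weight B\<^sub>\<Lambda> b i t = lam i))"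
    if "\<exists>!b. pwfk_optimal M T X s s0 B\<^sub>\<Lambda> c b" "pwfk_optimal M T X s s0 B\<^sub>\<Lambda> c b" for b
    using unique_b[OF unique_lam[OF that(1)] that(2)] ok_x assms(12)
    by (intro exI[of _ x]) (simp add: pwfk_weight_def)
  have ex_ok: "\<exists>lam. okfd_optimal M T X s s0 lam" using ok_x by blast
  show ?thesis
    by (intro conjI allI impI ballI ex_ok ok_pw ex1_iff; rule weights const_weights; assumption)
qed

end
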